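(* For every finite set of integers $L$ with $|L|=n$: - $\operatorname{Tree}$ is a bijection from packed alternative tableaux labeled by $L$ to plane alternative trees with $n$ vertices labeled by $L$; - $\operatorname{Forest}$ is a bijection from alternative tableaux labeled by $L$ (of length $n$) to plane alternative forests with $n$ vertices labeled by $L$.
   Context: A shape of length $n$ is a Ferrers diagram in English notation, possibly with empty rows or columns. It is determined by its south-east border, a path of $n$ unit south/west steps from the top-right corner to the bottom-left corner. South steps correspond to rows and west steps to columns. The shape is labeled by $L=\{i_1<\dots<i_n\}$ if $i_1,\dots,i_n$ are attached to rows and columns in the order their steps occur along the south-east border from top-right to bottom-left. Hence the top row (if any) and the leftmost column carry the smallest and the largest labels respectively among rows and among columns, and cell $(i,j)$ (row $i$, column $j$) exists iff $i<j$. An alternative tableau is a shape with a partial filling of cells by left and up arrows such that every cell to the left of a left arrow in its row and every cell above an up arrow in its column is empty. A free row (column) is one with no left (up) arrow. $Free(T)$ is the set of labels of free rows and columns. $\mathcal{A}_{i,j}$ denotes alternative tableaux with exactly $i$ free rows and $j$ free columns. A packed tableau is a tableau of positive length in $\mathcal{A}_{0,1}\cup\mathcal{A}_{1,0}$. For $k\in Free(T)$, $T(k)$ is the smallest $X\subseteq L$ containing $k$ such that for every arrow cell $(i,j)$, $i\in X$ iff $j\in X$. $T[k]$ is the labeled tableau with label set $T(k)$, rows/columns as in $T$, and cell $(i,j)$ filled as in $T$. $\operatorname{split}(T)=\{T[k]:k\in Free(T)\}$; these are packed tableaux whose label sets partition $L$. $cut_r$ deletes the top row of a tableau, keeping the labels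 of the remaining rows and columns. $cut_c$ deletes the leftmost column, keeping labels likewise. A vertex of a labeled rooted tree is minimal (maximal) if its label is smaller (larger) than the labels of all its descendants. A plane alternative tree is a rooted plane tree with pairwise distinct integer labels and vertices colored black or white such that: - every white vertex is minimal, and its children are black with labels decreasing from left to right; - every black vertex is maximal, and its children are white with labels increasing from left to right. A plane alternative forest is a set of plane alternative trees with pairwise disjoint label sets. $\operatorname{Tree}$ is defined recursively on labeled packed tableaux $T$: - If $T\in\mathcal{A}_{1,0}$, let $\ell$ be the label of its top row and let $T'_1,\dots,T'_m$ be the tableaux of $\operatorname{split}(cut_r(T))$. Then $\operatorname{Tree}(T)$ has a white root labeled $\ell$ whose subtrees are $\operatorname{Tree}(T'_1),\dots,\operatorname{Tree}(T'_m)$, arranged from left to right in decreasing order of their root labels. - If $T\in\mathcal{A}_{0,1}$, let $\ell$ be the label of its leftmost column and let $T'_1,\dots,T'_m$ be the tableaux of $\operatorname{split}(cut_c(T))$. Then $\operatorname{Tree}(T)$ has a black root labeled $\ell$ whose subtrees are $\operatorname{Tree}(T'_1),\dots,\operatorname{Tree}(T'_m)$, arranged from left to right in increasing order of their root labels. For any labeled alternative tableau $T$, $\operatorname{Forest}(T)=\{\operatorname{Tree}(U):U\in\operatorname{split}(T)\}$. *)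

theory Defs
  imports Main
begin

section \<open>Labeled alternative tableaux\<close>

datatype step = South | West

datatype arrow = LeftArrow | UpArrow

text \<open>
  A shape labeled by \<open>L\<close> is given by its labeled south-east border: \<open>border T\<close> has domain \<open>L\<close>
  and assigns to each label the step carrying it, so that the border path, read from the top-right
  to the bottom-left corner, is the sequence of steps in increasing order of labels.
  Hence rows are labeled increasingly from top to bottom and columns from \<^emph>\<open>right to left\<close>.
  \<open>fill T (i, j)\<close> is the content of the cell in row \<open>i\<close> and column \<open>j\<close> (\<open>None\<close> if it is empty;
  tableaux are required to have \<open>None\<close> outside the shape as well).
\<close>

record tableau =
  border :: "int \<rightharpoonup> step"
  fill :: "int \<times> int \<rightharpoonup> arrow"

definition labels :: "tableau \<Rightarrow> int set" where
  "labels T = dom (border T)"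

definition tableau_length :: "tableau \<Rightarrow> nat" where
  "tableau_length T = card (labels T)"

definition rows :: "tableau \<Rightarrow> int set" where
  "rows T = {i. border T i = Some South}"

definition cols :: "tableau \<Rightarrow> int set" where
  "cols T = {j. border T j = Some West}"

definition cells :: "tableau \<Rightarrow> (int \<times> int) set" where
  "cells T = {(i, j). i \<in> rows T \<and> j \<in> cols T \<and> i < j}"

definition alternative_tableau :: "tableau \<Rightarrow> bool" where
  "alternative_tableau T \<longleftrightarrow>
     finite (labels T) \<and>
     dom (fill T) \<subseteq> cells T \<and>
     \<comment> \<open>a larger column label means further left, a smaller row label means further up\<close>
     (\<forall>i j j'. fill T (i, j) = Some LeftArrow \<and> j < j' \<longrightarrow> fill T (i, j') = None) \<and>
     (\<forall>i i' j. fill T (i, j) = Some UpArrow \<and> i' < i \<longrightarrow> fill T (i', j) = None)"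

definition free_rows :: "tableau \<Rightarrow> int set" where
  "free_rows T = {i \<in> rows T. \<forall>j. fill T (i, j) \<noteq> Some LeftArrow}"

definition free_cols :: "tableau \<Rightarrow> int set" where
  "free_cols T = {j \<in> cols T. \<forall>i. fill T (i, j) \<noteq> Some UpArrow}"

definition Free :: "tableau \<Rightarrow> int set" where
  "Free T = free_rows T \<union> free_cols T"

definition alt_tableaux :: "nat \<Rightarrow> nat \<Rightarrow> tableau set"  ("\<A>") where
  "\<A> i j = {T. alternative_tableau T \<and> card (free_rows T) = i \<and> card (free_cols T) = j}"

definition packed :: "tableau \<Rightarrow> bool" where
  "packed T \<longleftrightarrow> tableau_length T > 0 \<and> T \<in> \<A> 0 1 \<union> \<A> 1 0"

definition restrict_tableau :: "tableau \<Rightarrow> int set \<Rightarrow> tableau" where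
  "restrict_tableau T X = \<lparr>border = border T |` X, fill = fill T |` (X \<times> X)\<rparr>"

text \<open>\<open>component T k\<close> is \<open>T(k)\<close> and \<open>subtableau T k\<close> is \<open>T[k]\<close>.\<close>

definition component :: "tableau \<Rightarrow> int \<Rightarrow> int set" where
  "component T k = \<Inter>{X. X \<subseteq> labels T \<and> k \<in> X \<and>
     (\<forall>(i, j) \<in> dom (fill T). i \<in> X \<longleftrightarrow> j \<in> X)}"

definition subtableau :: "tableau \<Rightarrow> int \<Rightarrow> tableau" where
  "subtableau T k = restrict_tableau T (component T k)"

definition split :: "tableau \<Rightarrow> tableau set" where
  "split T = subtableau T ` Free T"

definition cut_r :: "tableau \<Rightarrow> tableau" where
  "cut_r T = restrict_tableau T (labels T - {Min (rows T)})"

definition cut_c :: "tableau \<Rightarrow> tableau" where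
  "cut_c T = restrict_tableau T (labels T - {Max (cols T)})"


section \<open>Plane alternative trees and forests\<close>

datatype color = Black | White

datatype ptree = Node (color: color) (root_label: int) (children: "ptree list")

text \<open>A vertex is represented by the subtree rooted at it.\<close>

primrec vertices :: "ptree \<Rightarrow> ptree list" where
  "vertices (Node c l ts) = Node c l ts # concat (map vertices ts)"

definition descendants :: "ptree \<Rightarrow> ptree list" where
  "descendants v = concat (map vertices (children v))"

definition num_vertices :: "ptree \<Rightarrow> nat" where
  "num_vertices t = length (vertices t)"

definition tree_labels :: "ptree \<Rightarrow> int set" where
  "tree_labels t = root_label ` set (vertices t)"

definition minimal_vertex :: "ptree \<Rightarrow> bool" where
  "minimal_vertex v \<longleftrightarrow> (\<forall>u \<in> set (descendants v). root_label v < root_label u)"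

definition maximal_vertex :: "ptree \<Rightarrow> bool" where
  "maximal_vertex v \<longleftrightarrow> (\<forall>u \<in> set (descendants v). root_label v > root_label u)"

definition plane_alternative_tree :: "ptree \<Rightarrow> bool" where
  "plane_alternative_tree t \<longleftrightarrow>
     distinct (map root_label (vertices t)) \<and>
     (\<forall>v \<in> set (vertices t).
        (color v = White \<longrightarrow>
           minimal_vertex v \<and>
           (\<forall>u \<in> set (children v). color u = Black) \<and>
           sorted_wrt (>) (map root_label (children v))) \<and>
        (color v = Black \<longrightarrow>
           maximal_vertex v \<and>
           (\<forall>u \<in> set (children v). color u = White) \<and>
           sorted_wrt (<) (map root_label (children v))))"

definition plane_alternative_forest :: "ptree set \<Rightarrow> bool" where
  "plane_alternative_forest F \<longleftrightarrow>
     finite F \<and>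
     (\<forall>t \<in> F. plane_alternative_tree t) \<and>
     pairwise (\<lambda>t u. disjnt (tree_labels t) (tree_labels u)) F"

definition forest_labels :: "ptree set \<Rightarrow> int set" where
  "forest_labels F = (\<Union>t \<in> F. tree_labels t)"

definition forest_num_vertices :: "ptree set \<Rightarrow> nat" where
  "forest_num_vertices F = (\<Sum>t \<in> F. num_vertices t)"


section \<open>The maps Tree and Forest\<close>

lemma labels_restrict [simp]: "labels (restrict_tableau T X) = labels T \<inter> X"
  by (auto simp: labels_def restrict_tableau_def)

lemma labels_split: "U \<in> split T \<Longrightarrow> labels U \<subseteq> labels T"
  by (auto simp: split_def subtableau_def)

lemma cut_r_length:
  assumes "T \<in> \<A> 1 0" "U \<in> split (cut_r T)"
  shows "tableau_length U < tableau_length T"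
proof -
  have fin: "finite (labels T)"
    using assms(1) by (simp add: alt_tableaux_def alternative_tableau_def)
  have sub: "rows T \<subseteq> labels T" by (auto simp: rows_def labels_def)
  have "free_rows T \<noteq> {}" using assms(1) by (auto simp: alt_tableaux_def)
  hence "rows T \<noteq> {}" by (auto simp: free_rows_def)
  hence "Min (rows T) \<in> labels T" using sub fin by (meson Min_in finite_subset subsetD)
  hence "labels U \<subset> labels T"
    using labels_split[OF assms(2)] by (auto simp: cut_r_def)
  thus ?thesis using fin by (simp add: tableau_length_def psubset_card_mono)
qed

lemma cut_c_length:
  assumes "T \<in> \<A> 0 1" "U \<in> split (cut_c T)"
  shows "tableau_length U < tableau_length T"
proof -
  have fin: "finite (labels T)"
    using assms(1) by (simp add: alt_tableaux_def alternative_tableau_def)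
  have sub: "cols T \<subseteq> labels T" by (auto simp: cols_def labels_def)
  have "free_cols T \<noteq> {}" using assms(1) by (auto simp: alt_tableaux_def)
  hence "cols T \<noteq> {}" by (auto simp: free_cols_def)
  hence "Max (cols T) \<in> labels T" using sub fin by (meson Max_in finite_subset subsetD)
  hence "labels U \<subset> labels T"
    using labels_split[OF assms(2)] by (auto simp: cut_c_def)
  thus ?thesis using fin by (simp add: tableau_length_def psubset_card_mono)
qed

definition arrange :: "(int \<Rightarrow> int \<Rightarrow> bool) \<Rightarrow> ptree set \<Rightarrow> ptree list" where
  "arrange r S = (THE ts. set ts = S \<and> sorted_wrt r (map root_label ts))"

lemma arrange_eqI:
  assumes "r = (<) \<or> r = (>)" "sorted_wrt r (map root_label ts)"
  shows "arrange r (set ts) = ts"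
  unfolding arrange_def
proof (rule the_equality)
  fix us assume us: "set us = set ts \<and> sorted_wrt r (map root_label us)"
  have "xs = ys" if "set xs = set ys" "sorted_wrt r (map root_label xs)"
    "sorted_wrt r (map root_label ys)" for xs ys
    using that
  proof (induction xs arbitrary: ys)
    case (Cons x xs)
    then obtain y ys' where ys: "ys = y # ys'" by (cases ys) auto
    have "x = y" using Cons.prems ys assms(1) by (auto simp: set_eq_iff) (metis order.asym)+
    moreover have "x \<notin> set xs" "y \<notin> set ys'" using Cons.prems ys assms(1) by auto
    ultimately have "set xs = set ys'" using Cons.prems(1) ys by auto
    with Cons.IH[of ys'] Cons.prems ys \<open>x = y\<close> show ?case by auto
  qed auto
  with us assms(2) show "us = ts" by blast
qed (use assms in auto)

text \<open>\<open>Tree\<close> is only meaningful on packed tableaux.\<close>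

function Tree :: "tableau \<Rightarrow> ptree" where
  "Tree T =
     (if packed T then
        if T \<in> \<A> 1 0
        then Node White (Min (rows T))
               (arrange (>) (Tree ` split (cut_r T)))
        else Node Black (Max (cols T))
               (arrange (<) (Tree ` split (cut_c T)))
      else undefined)"
  by pat_completeness auto
termination
  by (relation "measure tableau_length")
    (auto simp: packed_def intro: cut_r_length cut_c_length)

declare Tree.simps [simp del]

definition Forest :: "tableau \<Rightarrow> ptree set" where
  "Forest T = Tree ` split T"

end

theory Submission
  imports Defs
begin

text \<open>
  Every non-free row contains exactly one left arrow and every non-free column exactly one up arrow.
  Taking the other line through that arrow as parent turns an alternative tableau into a forest on
  its labels, and the two emptiness conditions say precisely that the grandchildren of a row have
  larger labels and those of a column smaller ones. Inductively, rows are minimal and columns are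
  maximal among their descendants, so the forest is an alternative one with rows as white and columns
  as black vertices; its plane structure is forced by the sorting of the children. Conversely the
  parent relation and the colours determine the tableau. The free lines are the roots, \<open>T(k)\<close>
  is the set of descendants of \<open>k\<close>, and cutting the top row or the leftmost column of a packed
  tableau removes the root, so \<open>Tree\<close> and \<open>Forest\<close> compute exactly this forest.
\<close>

text \<open>\<open>color_ord c\<close> relates the descendants of a vertex of colour \<open>c\<close> to that vertex, and is also
  the left-to-right order of its children.\<close>

definition color_ord :: "color \<Rightarrow> int \<Rightarrow> int \<Rightarrow> bool" where
  "color_ord c = (case c of White \<Rightarrow> (>) | Black \<Rightarrow> (<))"

lemma color_ord_simps [simp]: "color_ord White = (>)" "color_ord Black = (<)"
  by (simp_all add: color_ord_def)

lemma color_ord_irrefl [simp]: "\<not> color_ord c x x"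
  by (cases c) auto

lemma color_ord_trans: "color_ord c x y \<Longrightarrow> color_ord c y z \<Longrightarrow> color_ord c x z"
  by (cases c) auto

lemma color_neq_iff: "c \<noteq> d \<longleftrightarrow> c = White \<and> d = Black \<or> c = Black \<and> d = White"
  by (cases c; cases d) auto

text \<open>Rows are to become white vertices and columns black ones; indexing the two sets by
  colour lets one statement cover both.\<close>

definition lines :: "tableau \<Rightarrow> color \<Rightarrow> int set" where
  "lines T c = (case c of White \<Rightarrow> rows T | Black \<Rightarrow> cols T)"

lemma lines_simps [simp]: "lines T White = rows T" "lines T Black = cols T"
  by (simp_all add: lines_def)

lemma labels_eq_rows_cols: "labels T = rows T \<union> cols T"
proof -
  have "border T x \<noteq> None \<longleftrightarrow> border T x = Some South \<or> border T x = Some West" for x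
    by (metis step.exhaust not_None_eq)
  thus ?thesis by (auto simp: labels_def rows_def cols_def)
qed

lemma labels_lines: "x \<in> labels T \<longleftrightarrow> (\<exists>c. x \<in> lines T c)"
  by (metis Un_iff color.exhaust labels_eq_rows_cols lines_simps)

lemma lines_unique: "x \<in> lines T c \<Longrightarrow> x \<in> lines T d \<Longrightarrow> c = d"
  by (cases c; cases d) (auto simp: rows_def cols_def)

subsection \<open>The parent relation of a tableau\<close>

text \<open>A left arrow in cell \<open>(i, j)\<close> makes column \<open>j\<close> the parent of row \<open>i\<close>, and an up arrow
  makes row \<open>i\<close> the parent of column \<open>j\<close>. Pairs are ordered as (child, parent).\<close>

definition parent_rel :: "tableau \<Rightarrow> (int \<times> int) set" where
  "parent_rel T = {(i, j). fill T (i, j) = Some LeftArrow} \<union> {(j, i). fill T (i, j) = Some UpArrow}"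

lemma dom_fill_iff: "fill T p \<noteq> None \<longleftrightarrow> fill T p = Some LeftArrow \<or> fill T p = Some UpArrow"
  by (metis arrow.exhaust not_None_eq)

lemma lines_restrict [simp]: "lines (restrict_tableau T X) c = lines T c \<inter> X"
  by (cases c) (auto simp: restrict_tableau_def rows_def cols_def restrict_map_def split: if_splits)

lemma parent_rel_restrict [simp]: "parent_rel (restrict_tableau T X) = parent_rel T \<inter> X \<times> X"
  by (auto simp: restrict_tableau_def parent_rel_def restrict_map_def split: if_splits)

text \<open>Restriction only erases arrows, and the emptiness conditions survive erasure. An arrow
  that remains has its row and its column in \<open>X\<close>, so its cell still belongs to the
  shape.\<close>

lemma alternative_restrict:
  assumes "alternative_tableau T"
  shows "alternative_tableau (restrict_tableau T X)"
proof -
  have fill: "fill (restrict_tableau T X) p = (if p \<in> X \<times> X then fill T p else None)" for p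
    by (auto simp: restrict_tableau_def restrict_map_def)
  have cells: "cells (restrict_tableau T X) = cells T \<inter> X \<times> X"
    using lines_restrict[of T X White] lines_restrict[of T X Black] by (auto simp: cells_def)
  have "finite (labels T)" "dom (fill T) \<subseteq> cells T"
    using assms by (simp_all add: alternative_tableau_def)
  hence "finite (labels (restrict_tableau T X))"
    "dom (fill (restrict_tableau T X)) \<subseteq> cells (restrict_tableau T X)"
    unfolding cells by (auto simp: fill split: if_splits)
  moreover have "fill (restrict_tableau T X) p = Some a \<Longrightarrow> fill T p = Some a"
    "fill T p = None \<Longrightarrow> fill (restrict_tableau T X) p = None" for p a
    by (auto simp: fill split: if_splits)
  ultimately show ?thesis
    using assms unfolding alternative_tableau_def by blast
qed

lemma converse_rtrancl_cases: "(x, y) \<in> r\<^sup>* \<longleftrightarrow> x = y \<or> (\<exists>z. (x, z) \<in> r \<and> (z, y) \<in> r\<^sup>*)"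
  by (meson converse_rtranclE converse_rtrancl_into_rtrancl rtrancl.rtrancl_refl)

context
  fixes T :: tableau
  assumes alt: "alternative_tableau T"
begin

lemma alt_fill_cell: "fill T (i, j) = Some a \<Longrightarrow> i \<in> rows T \<and> j \<in> cols T \<and> i < j"
  using alt unfolding alternative_tableau_def cells_def by blast

lemma parent_rel_lines:
  assumes "(x, y) \<in> parent_rel T"
  obtains c d where "x \<in> lines T d" "y \<in> lines T c" "c \<noteq> d" "color_ord c x y"
  using assms alt_fill_cell[of x y] alt_fill_cell[of y x] that[of White Black] that[of Black White]
  by (auto simp: parent_rel_def)

lemma parent_rel_ord: "(x, y) \<in> parent_rel T \<Longrightarrow> y \<in> lines T c \<Longrightarrow> color_ord c x y"
  by (metis parent_rel_lines lines_unique)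

text \<open>Each edge joins a row and a column, so colours alternate along every chain of
  parents.\<close>

lemma parent_rel_child_lines:
  assumes "(x, y) \<in> parent_rel T" "c \<noteq> d"
  shows "y \<in> lines T c \<longleftrightarrow> x \<in> lines T d"
proof -
  obtain c' d' where "x \<in> lines T d'" "y \<in> lines T c'" "c' \<noteq> d'"
    using assms(1) by (rule parent_rel_lines)
  thus ?thesis using assms(2) lines_unique by (auto simp: color_neq_iff)
qed

lemma parent_rel_labels: "parent_rel T \<subseteq> labels T \<times> labels T"
  by (clarsimp simp: labels_lines) (metis parent_rel_lines)

text \<open>\<open>parent_rel\<close> merges both kinds of arrow without loss: the child is the row
  for a left arrow and the column for an up arrow, so the colour of the child tells the
  kind.\<close>

lemma fill_Left_iff: "fill T (i, j) = Some LeftArrow \<longleftrightarrow> (i, j) \<in> parent_rel T \<and> i \<in> rows T"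
  using alt_fill_cell[of i j] alt_fill_cell[of j i] by (auto simp: parent_rel_def rows_def cols_def)

lemma fill_Up_iff: "fill T (i, j) = Some UpArrow \<longleftrightarrow> (j, i) \<in> parent_rel T \<and> j \<in> cols T"
  using alt_fill_cell[of i j] alt_fill_cell[of j i] by (auto simp: parent_rel_def rows_def cols_def)

lemma alt_Left: "fill T (i, j) = Some LeftArrow \<Longrightarrow> j < j' \<Longrightarrow> fill T (i, j') = None"
  using alt unfolding alternative_tableau_def by blast

lemma alt_Up: "fill T (i, j) = Some UpArrow \<Longrightarrow> i' < i \<Longrightarrow> fill T (i', j) = None"
  using alt unfolding alternative_tableau_def by blast

text \<open>Of two left arrows in one row, one lies to the left of the other; of two up arrows in
  one column, one lies above the other. The emptiness conditions forbid both.\<close>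

lemma single_valued_parent_rel: "single_valued (parent_rel T)"
proof (rule single_valuedI)
  fix x y z assume *: "(x, y) \<in> parent_rel T" "(x, z) \<in> parent_rel T"
  then obtain d where d: "x \<in> lines T d" by (auto elim: parent_rel_lines)
  show "y = z"
  proof (cases d)
    case White
    hence "fill T (x, y) = Some LeftArrow" "fill T (x, z) = Some LeftArrow"
      using * d fill_Left_iff by auto
    thus ?thesis using alt_Left by (metis linorder_neqE option.distinct(1))
  next
    case Black
    hence "fill T (y, x) = Some UpArrow" "fill T (z, x) = Some UpArrow"
      using * d fill_Up_iff by auto
    thus ?thesis using alt_Up by (metis linorder_neqE option.distinct(1))
  qed
qed

text \<open>Both edges are arrows in the line \<open>x\<close>, of opposite kinds and hence in
  different cells. The arrow that gives \<open>x\<close> its parent \<open>y\<close> keeps all cells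
  beyond it empty, so \<open>z\<close> lies on the near side of \<open>y\<close>.\<close>

lemma grandparent_ord:
  assumes "(z, x) \<in> parent_rel T" "(x, y) \<in> parent_rel T" "y \<in> lines T c"
  shows "color_ord c z y"
proof (cases c)
  case White
  hence "x \<in> cols T" "z \<in> rows T"
    using assms parent_rel_child_lines[of x y White Black]
      parent_rel_child_lines[of z x Black White] by auto
  hence L: "fill T (z, x) = Some LeftArrow" and U: "fill T (y, x) = Some UpArrow"
    using assms fill_Left_iff fill_Up_iff by auto
  have "z \<noteq> y" using L U by auto
  moreover have "\<not> z < y" using alt_Up[OF U, of z] L by auto
  ultimately show ?thesis using White by auto
next
  case Black
  hence "x \<in> rows T" "z \<in> cols T"
    using assms parent_rel_child_lines[of x y Black White]
      parent_rel_child_lines[of z x White Black] by auto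
  hence U: "fill T (x, z) = Some UpArrow" and L: "fill T (x, y) = Some LeftArrow"
    using assms fill_Left_iff fill_Up_iff by auto
  have "z \<noteq> y" using L U by auto
  moreover have "\<not> y < z" using alt_Left[OF L, of z] U by auto
  ultimately show ?thesis using Black by auto
qed

text \<open>A child of
  a vertex of the colour opposite to \<open>y\<close> is compared with \<open>y\<close> through its grandparent, so the
  induction has to carry the claim along for the parent as well.\<close>

lemma trancl_parent_rel_ord:
  assumes "(x, y) \<in> (parent_rel T)\<^sup>+" "y \<in> lines T c"
  shows "color_ord c x y"
proof -
  have "color_ord c x y \<and> (\<forall>x'. (x, x') \<in> parent_rel T \<longrightarrow> x' = y \<or> color_ord c x' y)"
    using assms(1)
  proof (induction rule: converse_trancl_induct)
    case (base x)
    thus ?case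
      using parent_rel_ord[OF _ assms(2)] single_valued_parent_rel by (auto dest: single_valuedD)
  next
    case (step w x)
    have "color_ord c w y"
    proof (cases "x \<in> lines T c")
      case True
      thus ?thesis using parent_rel_ord[OF step(1)] step color_ord_trans by blast
    next
      case False
      obtain x' where x': "(x, x') \<in> parent_rel T" using step(2) by (meson tranclD)
      have "x' \<in> lines T c"
        using x' False parent_rel_child_lines[OF x'] by (metis parent_rel_lines color_neq_iff)
      hence "color_ord c w x'" using grandparent_ord[OF step(1) x'] by blast
      thus ?thesis using step x' color_ord_trans by blast
    qed
    moreover have "x' = x" if "(w, x') \<in> parent_rel T" for x'
      using that step(1) single_valued_parent_rel by (auto dest: single_valuedD)
    ultimately show ?case using step by blast
  qed
  thus ?thesis by blast
qed

section \<open>Free lines as roots, components as sets of descendants\<close>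

lemma Free_eq: "Free T = labels T - Domain (parent_rel T)"
proof -
  have "x \<in> free_rows T \<longleftrightarrow> x \<in> rows T \<and> x \<notin> Domain (parent_rel T)" for x
    using fill_Left_iff by (auto simp: free_rows_def)
  moreover have "x \<in> free_cols T \<longleftrightarrow> x \<in> cols T \<and> x \<notin> Domain (parent_rel T)" for x
    using fill_Up_iff by (auto simp: free_cols_def)
  ultimately show ?thesis by (auto simp: Free_def labels_eq_rows_cols)
qed

text \<open>The strict comparison in \<open>trancl_parent_rel_ord\<close> excludes cycles, and
  finiteness turns this into termination of the ascent from child to parent.\<close>

lemma wf_converse_parent_rel: "wf ((parent_rel T)\<inverse>)"
proof (rule finite_acyclic_wf_converse)
  show "finite (parent_rel T)"
    using alt parent_rel_labels finite_subset unfolding alternative_tableau_def by blast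
  show "acyclic (parent_rel T)"
  proof (rule acyclicI, intro allI notI)
    fix x assume *: "(x, x) \<in> (parent_rel T)\<^sup>+"
    then obtain y where "(x, y) \<in> parent_rel T" by (blast dest: tranclD)
    then obtain c where "x \<in> lines T c" by (rule parent_rel_lines)
    with trancl_parent_rel_ord[OF *] show False by auto
  qed
qed

lemma ex_free_ancestor: "x \<in> labels T \<Longrightarrow> \<exists>k \<in> Free T. (x, k) \<in> (parent_rel T)\<^sup>*"
proof (induction x rule: wf_induct_rule[OF wf_converse_parent_rel])
  case (1 x)
  show ?case
  proof (cases "x \<in> Free T")
    case False
    then obtain y where y: "(x, y) \<in> parent_rel T" using 1 by (auto simp: Free_eq)
    hence "y \<in> labels T" using parent_rel_labels by auto
    with 1 y show ?thesis by (meson converseI converse_rtrancl_into_rtrancl)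
  qed auto
qed

text \<open>The descendants of \<open>k\<close> are closed under children, and also under parents
  because parents are unique and \<open>k\<close> has none. Conversely, a closed set containing
  \<open>k\<close> picks up all descendants by walking down the edges.\<close>

lemma component_eq:
  assumes "k \<in> Free T"
  shows "component T k = {x. (x, k) \<in> (parent_rel T)\<^sup>*}"
proof -
  \<comment> \<open>An arrow cell and its edge have the same two end points, and the closure
    condition is symmetric in them.\<close>
  have closed_iff: "(\<forall>(i, j) \<in> dom (fill T). i \<in> X \<longleftrightarrow> j \<in> X) \<longleftrightarrow>
    (\<forall>(x, y) \<in> parent_rel T. x \<in> X \<longleftrightarrow> y \<in> X)" (is "?l X \<longleftrightarrow> ?r X") for X
  proof
    assume "?l X" thus "?r X" by (auto simp: parent_rel_def)
  next
    assume r: "?r X"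
    show "?l X"
    proof (clarify)
      fix i j a assume "fill T (i, j) = Some a"
      hence "(i, j) \<in> parent_rel T \<or> (j, i) \<in> parent_rel T"
        by (cases a) (auto simp: parent_rel_def)
      thus "i \<in> X \<longleftrightarrow> j \<in> X" using r by blast
    qed
  qed
  let ?D = "{x. (x, k) \<in> (parent_rel T)\<^sup>*}"
  have k: "k \<in> labels T" "k \<notin> Domain (parent_rel T)" using assms by (auto simp: Free_eq)
  have lab: "?D \<subseteq> labels T"
    using k parent_rel_labels by (subst converse_rtrancl_cases) auto
  have cl: "x \<in> ?D \<longleftrightarrow> y \<in> ?D" if "(x, y) \<in> parent_rel T" for x y
  proof
    assume "x \<in> ?D"
    moreover have "x \<noteq> k" using that k by auto
    ultimately obtain z where "(x, z) \<in> parent_rel T" "z \<in> ?D"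
      by (auto simp: converse_rtrancl_cases[of x k])
    thus "y \<in> ?D" using that single_valued_parent_rel by (metis single_valuedD)
  next
    assume "y \<in> ?D" thus "x \<in> ?D" using that by (auto intro: converse_rtrancl_into_rtrancl)
  qed
  have "component T k \<subseteq> ?D"
    unfolding component_def closed_iff using lab cl by (intro Inter_lower) auto
  moreover have "x \<in> X" if "(x, k) \<in> (parent_rel T)\<^sup>*" "k \<in> X" "?r X" for x X
    using that(1) by (induction rule: converse_rtrancl_induct) (use that in auto)
  hence "?D \<subseteq> component T k"
    unfolding component_def closed_iff by blast
  ultimately show ?thesis by blast
qed

lemma component_subset_labels:
  assumes "k \<in> Free T" shows "component T k \<subseteq> labels T"
  using assms parent_rel_labels
  by (simp add: component_eq, subst converse_rtrancl_cases) (auto simp: Free_eq)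

lemma component_closed:
  assumes "k \<in> Free T" "(x, y) \<in> parent_rel T"
  shows "x \<in> component T k \<longleftrightarrow> y \<in> component T k"
proof
  assume "x \<in> component T k"
  hence "(x, k) \<in> (parent_rel T)\<^sup>*" "x \<noteq> k" using assms by (auto simp: component_eq Free_eq)
  then obtain z where "(x, z) \<in> parent_rel T" "(z, k) \<in> (parent_rel T)\<^sup>*"
    by (auto simp: converse_rtrancl_cases[of x k])
  thus "y \<in> component T k"
    using assms single_valued_parent_rel by (simp add: component_eq) (metis single_valuedD)
qed (use assms in \<open>auto simp: component_eq intro: converse_rtrancl_into_rtrancl\<close>)

text \<open>Parents are unique, so of two ancestors of one label, one is reached from the other.
  Distinct free labels cannot be related like this, as neither has a parent.\<close>

lemma components_disjoint:
  assumes "k \<in> Free T" "k' \<in> Free T" "k \<noteq> k'"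
  shows "component T k \<inter> component T k' = {}"
proof -
  have "(x, k) \<in> (parent_rel T)\<^sup>* \<Longrightarrow> (x, k') \<in> (parent_rel T)\<^sup>* \<Longrightarrow> False" for x
    using single_valued_confluent[OF single_valued_parent_rel, of x k k'] assms
    by (auto simp: Free_eq converse_rtrancl_cases[of k k'] converse_rtrancl_cases[of k' k])
  thus ?thesis using assms by (auto simp: component_eq)
qed

lemma UN_components: "(\<Union>k \<in> Free T. component T k) = labels T"
  using component_subset_labels ex_free_ancestor by (auto simp: component_eq)

lemma alternative_subtableau: "alternative_tableau (subtableau T k)"
  by (simp add: subtableau_def alternative_restrict[OF alt])

end

text \<open>The component is closed under \<open>parent_rel\<close>, so each of its labels other
  than \<open>k\<close> keeps its parent in the subtableau.\<close>

lemma Free_subtableau: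
  assumes "alternative_tableau T" "k \<in> Free T"
  shows "Free (subtableau T k) = {k}"
proof -
  note alt = assms(1)
  have "x = k" if "x \<in> component T k" "x \<notin> Domain (parent_rel T \<inter> component T k \<times> component T k)" for x
    using that component_closed[OF alt assms(2)] component_eq[OF alt assms(2)]
    by (auto simp: converse_rtrancl_cases[of x k])
  moreover have "k \<in> component T k" using component_eq[OF alt assms(2)] by auto
  ultimately show ?thesis
    using component_subset_labels[OF assms] assms(2)
    unfolding Free_eq[OF alternative_subtableau[OF alt]]
    by (auto simp: subtableau_def Free_eq[OF alt])
qed

section \<open>Packed tableaux and removal of the root\<close>

text \<open>Free rows and free columns are disjoint, so the two cases of the definition together
  mean one free line in total. Packed tableaux are thus those whose forest is a single tree.\<close>

lemma packed_iff: "packed T \<longleftrightarrow> alternative_tableau T \<and> (\<exists>r. Free T = {r})"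
proof (cases "alternative_tableau T")
  case alt: True
  have sub: "free_rows T \<subseteq> labels T" "free_cols T \<subseteq> labels T"
    by (auto simp: free_rows_def free_cols_def labels_eq_rows_cols)
  have fin: "finite (labels T)" using alt by (simp add: alternative_tableau_def)
  have fin': "finite (free_rows T)" "finite (free_cols T)"
    using sub fin finite_subset by blast+
  have disj: "free_rows T \<inter> free_cols T = {}"
    by (auto simp: free_rows_def free_cols_def rows_def cols_def)
  have "card (Free T) = card (free_rows T) + card (free_cols T)"
    using fin' disj by (simp add: Free_def card_Un_disjoint)
  hence "T \<in> \<A> 0 1 \<union> \<A> 1 0 \<longleftrightarrow> card (Free T) = 1"
    using alt by (auto simp: alt_tableaux_def)
  moreover have "tableau_length T > 0" if "card (Free T) = 1"
    using that sub fin unfolding Free_def tableau_length_def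
    by (metis Un_least card_gt_0_iff card.empty subset_empty zero_neq_one)
  ultimately show ?thesis using alt by (auto simp: packed_def card_1_singleton_iff)
qed (auto simp: packed_def alt_tableaux_def)

lemma packed_subtableau: "alternative_tableau T \<Longrightarrow> k \<in> Free T \<Longrightarrow> packed (subtableau T k)"
  by (simp add: packed_iff alternative_subtableau Free_subtableau)

text \<open>All other labels are descendants of the only free line, so that line is extreme among
  all labels, rows and columns alike.\<close>

lemma root_ord:
  assumes "alternative_tableau T" "Free T = {r}" "r \<in> lines T c" "x \<in> labels T" "x \<noteq> r"
  shows "color_ord c x r"
  using ex_free_ancestor[OF assms(1,4)] trancl_parent_rel_ord[OF assms(1) _ assms(3)] assms
  by (auto dest: rtranclD)

text \<open>Common form of the cuts performed by \<open>Tree\<close>, in which the deleted top row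
  or leftmost column is the root \<open>r\<close>.\<close>

definition cut_root :: "tableau \<Rightarrow> int \<Rightarrow> tableau" where
  "cut_root T r = restrict_tableau T (labels T - {r})"

text \<open>By \<open>root_ord\<close> a root that is a row is the smallest label and a root that is
  a column the largest, so it is the line that the recursion cuts and takes as root label.\<close>

lemma Tree_unfold:
  assumes alt: "alternative_tableau T" and r: "Free T = {r}" "r \<in> lines T c"
  shows "Tree T = Node c r (arrange (color_ord c) (Tree ` split (cut_root T r)))"
proof -
  have fin: "finite (rows T)" "finite (cols T)"
    using alt by (simp_all add: alternative_tableau_def labels_eq_rows_cols)
  have p: "packed T" using alt r packed_iff by blast
  have fr: "free_rows T \<union> free_cols T = {r}" using r by (simp add: Free_def)
  show ?thesis
  proof (cases c)
    case White
    have "Min (rows T) = r"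
      using r root_ord[OF alt r] fin White by (intro Min_eqI) (force simp: labels_eq_rows_cols)+
    \<comment> \<open>No label is both a row and a column, so the colour of \<open>r\<close> decides
      which branch of \<open>Tree\<close> applies.\<close>
    moreover have "r \<notin> cols T" using r White lines_unique[of r T White Black] by auto
    hence "free_rows T = {r}" "free_cols T = {}" using fr by (auto simp: free_cols_def)
    hence "T \<in> \<A> 1 0" using alt by (simp add: alt_tableaux_def)
    ultimately show ?thesis
      using p White by (subst Tree.simps) (simp add: cut_r_def cut_root_def)
  next
    case Black
    have "Max (cols T) = r"
      using r root_ord[OF alt r] fin Black by (intro Max_eqI) (force simp: labels_eq_rows_cols)+
    moreover have "r \<notin> rows T" using r Black lines_unique[of r T White Black] by auto
    hence "free_rows T = {}" using fr by (auto simp: free_rows_def)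
    hence "T \<notin> \<A> 1 0" by (simp add: alt_tableaux_def)
    ultimately show ?thesis
      using p Black by (subst Tree.simps) (simp add: cut_c_def cut_root_def)
  qed
qed

text \<open>Deleting \<open>r\<close> removes exactly the edges into \<open>r\<close>. Since parents
  are unique, the labels left without a parent are the children of \<open>r\<close>.\<close>

lemma Free_cut_root:
  assumes "alternative_tableau T" "Free T = {r}"
  shows "Free (cut_root T r) = {x. (x, r) \<in> parent_rel T}"
proof -
  note alt = assms(1)
  \<comment> \<open>\<open>r\<close> is the only free label, so every other label has a
    parent.\<close>
  have *: "x \<in> Domain (parent_rel T) \<longleftrightarrow> x \<in> labels T \<and> x \<noteq> r" for x
    using Free_eq[OF alt] assms(2) parent_rel_labels[OF alt] by auto
  have "Free (cut_root T r) = labels T - {r} - Domain (parent_rel T \<inter> (labels T - {r}) \<times> (labels T - {r}))"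
    unfolding cut_root_def Free_eq[OF alternative_restrict[OF alt]] by auto
  also have "\<dots> = {x. (x, r) \<in> parent_rel T}"
    using * parent_rel_labels[OF alt] single_valued_parent_rel[OF alt]
    by (auto dest: single_valuedD)
  finally show ?thesis .
qed

section \<open>Tableaux determined by, and built from, a parent relation\<close>

lemma tableau_eqI:
  assumes alt: "alternative_tableau T" "alternative_tableau U"
    and eq: "\<And>c. lines T c = lines U c" "parent_rel T = parent_rel U"
  shows "T = U"
proof -
  have rc: "rows T = rows U" "cols T = cols U" using eq(1)[of White] eq(1)[of Black] by auto
  have border: "border V x = (if x \<in> rows V then Some South else if x \<in> cols V then Some West else None)"
    for V :: tableau and x
    by (cases "border V x") (auto simp: rows_def cols_def split: if_splits intro: step.exhaust)
  have "border T = border U"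
    by (rule ext) (simp add: border rc)
  moreover have "fill T (i, j) = fill U (i, j)" for i j
  proof -
    have "fill T (i, j) = Some LeftArrow \<longleftrightarrow> fill U (i, j) = Some LeftArrow"
      "fill T (i, j) = Some UpArrow \<longleftrightarrow> fill U (i, j) = Some UpArrow"
      using fill_Left_iff[OF alt(1)] fill_Left_iff[OF alt(2)]
        fill_Up_iff[OF alt(1)] fill_Up_iff[OF alt(2)] rc eq(2) by auto
    thus ?thesis using dom_fill_iff[of T "(i, j)"] dom_fill_iff[of U "(i, j)"] by metis
  qed
  hence "fill T = fill U" by auto
  ultimately show ?thesis by (simp add: ext)
qed

text \<open>Each edge becomes an arrow whose kind is read off from the colour of the child.
  \<open>par\<close> places the arrows in cells of the shape, while \<open>sv\<close> and
  \<open>grand\<close> yield the two emptiness conditions.\<close>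

lemma ex_tableau_of_parent_rel:
  assumes fin: "finite (R \<union> C)" and disj: "R \<inter> C = {}"
    and par: "\<And>x y. (x, y) \<in> P \<Longrightarrow> x \<in> R \<and> y \<in> C \<and> x < y \<or> x \<in> C \<and> y \<in> R \<and> y < x"
    and sv: "single_valued P"
    and grand: "\<And>x y z. (z, x) \<in> P \<Longrightarrow> (x, y) \<in> P \<Longrightarrow> (if y \<in> R then y < z else z < y)"
  shows "\<exists>T. alternative_tableau T \<and> rows T = R \<and> cols T = C \<and> parent_rel T = P"
proof -
  define T where "T = \<lparr>
    border = (\<lambda>x. if x \<in> R then Some South else if x \<in> C then Some West else None),
    fill = (\<lambda>(i, j). if (i, j) \<in> P \<and> i \<in> R then Some LeftArrow
                      else if (j, i) \<in> P \<and> i \<in> R then Some UpArrow else None)\<rparr>"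
  have rc: "rows T = R" "cols T = C" "labels T = R \<union> C"
    using disj by (auto simp: T_def rows_def cols_def labels_def split: if_splits)
  \<comment> \<open>With edges in both directions \<open>x\<close> would be its own grandparent,
    contradicting the strict order in \<open>grand\<close>. Hence the first branch of
    \<open>fill\<close> never hides an up arrow.\<close>
  have not_both: "(y, x) \<notin> P" if "(x, y) \<in> P" for x y
    using grand[of x y x] that by (auto split: if_splits)
  have L: "fill T (i, j) = Some LeftArrow \<longleftrightarrow> (i, j) \<in> P \<and> i \<in> R"
    and U: "fill T (i, j) = Some UpArrow \<longleftrightarrow> (j, i) \<in> P \<and> i \<in> R" for i j
    using not_both by (auto simp: T_def)
  have P: "parent_rel T = P"
    unfolding parent_rel_def using L U par disj by fastforce
  have "alternative_tableau T"
    unfolding alternative_tableau_def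
  proof (intro conjI allI impI)
    show "finite (labels T)" using fin rc by simp
    show "dom (fill T) \<subseteq> cells T"
    proof clarify
      fix i j a assume "fill T (i, j) = Some a"
      hence "i \<in> R" "(i, j) \<in> P \<or> (j, i) \<in> P" using L U by (cases a; auto)+
      thus "(i, j) \<in> cells T" using par disj rc by (fastforce simp: cells_def)
    qed
  next
    fix i j j' assume *: "fill T (i, j) = Some LeftArrow \<and> j < j'"
    hence ij: "(i, j) \<in> P" "i \<in> R" using L by auto
    hence j: "j \<notin> R" using par disj by blast
    \<comment> \<open>A second left arrow would give \<open>i\<close> two parents. An up arrow
      further left would make \<open>j'\<close> a grandchild of the column \<open>j\<close>, which
      forces \<open>j' < j\<close>. The case of up arrows below is symmetric.\<close>
    have "(i, j') \<notin> P" using ij sv * by (auto dest: single_valuedD)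
    moreover have "(j', i) \<notin> P" using grand[of j' i j] ij j * by auto
    ultimately have "fill T (i, j') \<noteq> Some LeftArrow" "fill T (i, j') \<noteq> Some UpArrow"
      using L U by auto
    thus "fill T (i, j') = None" using dom_fill_iff by metis
  next
    fix i i' j assume *: "fill T (i, j) = Some UpArrow \<and> i' < i"
    hence ij: "(j, i) \<in> P" "i \<in> R" using U by auto
    have "(j, i') \<notin> P" using ij sv * by (auto dest: single_valuedD)
    moreover have "(i', j) \<notin> P" using grand[of i' j i] ij * by auto
    ultimately have "fill T (i', j) \<noteq> Some LeftArrow" "fill T (i', j) \<noteq> Some UpArrow"
      using L U by auto
    thus "fill T (i', j) = None" using dom_fill_iff by metis
  qed
  thus ?thesis using rc P by blast
qed


subsection \<open>Edges and colours of plane alternative trees\<close>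

text \<open>Pairs are (child, parent) as in \<open>parent_rel\<close>, so that the two relations can
  be equated.\<close>

primrec tree_edges :: "ptree \<Rightarrow> (int \<times> int) set" where
  "tree_edges (Node c l ts) = (\<lambda>u. (root_label u, l)) ` set ts \<union> \<Union> (set (map tree_edges ts))"

text \<open>The counterpart of \<open>lines\<close> on the side of trees.\<close>

definition color_labels :: "color \<Rightarrow> ptree \<Rightarrow> int set" where
  "color_labels c t = root_label ` {v \<in> set (vertices t). color v = c}"

lemma color_labels_Node:
  "color_labels d (Node c l ts) = (if d = c then {l} else {}) \<union> (\<Union>u \<in> set ts. color_labels d u)"
proof -
  have "{v \<in> set (vertices (Node c l ts)). color v = d} =
    (if d = c then {Node c l ts} else {}) \<union> (\<Union>u \<in> set ts. {v \<in> set (vertices u). color v = d})"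
    by auto
  thus ?thesis by (simp add: color_labels_def image_Un image_UN)
qed

lemma tree_labels_Node: "tree_labels (Node c l ts) = insert l (\<Union>u \<in> set ts. tree_labels u)"
  by (auto simp: tree_labels_def)

lemma tree_labels_color_labels: "x \<in> tree_labels t \<longleftrightarrow> (\<exists>c. x \<in> color_labels c t)"
  by (auto simp: tree_labels_def color_labels_def)

lemma root_in_color_labels: "root_label t \<in> color_labels (color t) t"
  by (cases t) (simp add: color_labels_Node)

lemma root_in_tree_labels [simp]: "root_label t \<in> tree_labels t"
  by (cases t) (simp add: tree_labels_Node)

lemma tree_labels_finite [simp]: "finite (tree_labels t)"
  by (simp add: tree_labels_def)

lemma tree_edges_subset: "tree_edges t \<subseteq> tree_labels t \<times> tree_labels t"
  by (induction t) (force simp: tree_labels_Node)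

lemma tree_edges_rtrancl: "x \<in> tree_labels t \<Longrightarrow> (x, root_label t) \<in> (tree_edges t)\<^sup>*"
proof (induction t)
  case (Node c l ts)
  show ?case
  proof (cases "x = l")
    case False
    then obtain u where u: "u \<in> set ts" "x \<in> tree_labels u" using Node.prems by (auto simp: tree_labels_Node)
    have "tree_edges u \<subseteq> tree_edges (Node c l ts)" using u by auto
    hence "(x, root_label u) \<in> (tree_edges (Node c l ts))\<^sup>*"
      using Node.IH[OF u] rtrancl_mono by blast
    moreover have "(root_label u, l) \<in> tree_edges (Node c l ts)" using u by auto
    ultimately show ?thesis by (simp only: ptree.sel rtrancl_into_rtrancl)
  qed simp
qed

lemma sorted_color_ord_distinct: "sorted_wrt (color_ord c) xs \<Longrightarrow> distinct xs"
  by (induction xs) auto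

text \<open>Translates distinctness of the label list below a root into the disjointness condition
  of a forest. Distinctness of \<open>ts\<close> is what allows passing from the list to its
  set.\<close>

lemma distinct_concat_vertices:
  assumes "distinct ts"
  shows "distinct (map root_label (concat (map vertices ts))) \<longleftrightarrow>
    (\<forall>u \<in> set ts. distinct (map root_label (vertices u))) \<and>
    pairwise (\<lambda>t u. disjnt (tree_labels t) (tree_labels u)) (set ts)"
  using assms
proof (induction ts)
  case (Cons a ts)
  have "set (map root_label (vertices a)) \<inter> set (map root_label (concat (map vertices ts))) = {} \<longleftrightarrow>
    (\<forall>u \<in> set ts. disjnt (tree_labels a) (tree_labels u))"
    by (fastforce simp: tree_labels_def disjnt_iff)
  moreover have "pairwise (\<lambda>t u. disjnt (tree_labels t) (tree_labels u)) (set (a # ts)) \<longleftrightarrow>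
    (\<forall>u \<in> set ts. disjnt (tree_labels a) (tree_labels u)) \<and>
    pairwise (\<lambda>t u. disjnt (tree_labels t) (tree_labels u)) (set ts)"
    using Cons.prems by (auto simp: pairwise_insert disjnt_sym)
  ultimately show ?case
    using Cons by (simp only: list.map concat.simps map_append distinct_append) auto
qed simp

text \<open>The form in which inductions on alternative trees use the definition: the conditions on
  all vertices split into those at the root and those inside the subtrees, and so does distinctness
  of labels.\<close>

lemma plane_alternative_tree_Node:
  "plane_alternative_tree (Node c l ts) \<longleftrightarrow>
     plane_alternative_forest (set ts) \<and>
     (\<forall>u \<in> set ts. color u \<noteq> c \<and> (\<forall>x \<in> tree_labels u. color_ord c x l)) \<and>
     sorted_wrt (color_ord c) (map root_label ts)" (is "?l \<longleftrightarrow> ?r")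
proof -
  let ?loc = "\<lambda>v. (color v = White \<longrightarrow>
           minimal_vertex v \<and>
           (\<forall>u \<in> set (children v). color u = Black) \<and>
           sorted_wrt (>) (map root_label (children v))) \<and>
        (color v = Black \<longrightarrow>
           maximal_vertex v \<and>
           (\<forall>u \<in> set (children v). color u = White) \<and>
           sorted_wrt (<) (map root_label (children v)))"
  let ?t = "Node c l ts"
  have loc: "?loc ?t \<longleftrightarrow> (\<forall>u \<in> set ts. color u \<noteq> c \<and> (\<forall>x \<in> tree_labels u. color_ord c x l)) \<and>
     sorted_wrt (color_ord c) (map root_label ts)"
    by (cases c) (auto simp: minimal_vertex_def maximal_vertex_def descendants_def tree_labels_def color_neq_iff)
  have verts: "(\<forall>v \<in> set (vertices ?t). ?loc v) \<longleftrightarrow> ?loc ?t \<and> (\<forall>u \<in> set ts. \<forall>v \<in> set (vertices u). ?loc v)"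
    by (simp only: vertices.simps) auto
  \<comment> \<open>The condition at the root is used here: sorted child labels mean that
    \<open>ts\<close> lists each child once, and the strict comparison keeps \<open>l\<close> out of
    the subtrees.\<close>
  have dist: "distinct (map root_label (vertices ?t)) \<longleftrightarrow>
      (\<forall>u \<in> set ts. distinct (map root_label (vertices u))) \<and>
      pairwise (\<lambda>t u. disjnt (tree_labels t) (tree_labels u)) (set ts)" if "?loc ?t"
  proof -
    have "distinct ts"
      using that unfolding loc using sorted_color_ord_distinct distinct_map by blast
    moreover have "l \<notin> tree_labels u" if "u \<in> set ts" for u
      using \<open>?loc ?t\<close> that unfolding loc by (metis color_ord_irrefl)
    hence "l \<notin> set (map root_label (concat (map vertices ts)))"
      by (auto simp: tree_labels_def)
    ultimately show ?thesis using distinct_concat_vertices[of ts] by simp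
  qed
  show ?thesis
    unfolding plane_alternative_forest_def plane_alternative_tree_def verts
    using dist loc by (simp only: finite_set) blast
qed

lemma root_notin_child_labels:
  assumes "plane_alternative_tree (Node c l ts)" "u \<in> set ts"
  shows "l \<notin> tree_labels u"
proof -
  have "\<forall>x \<in> tree_labels u. color_ord c x l"
    using assms by (simp add: plane_alternative_tree_Node)
  thus ?thesis by (metis color_ord_irrefl)
qed

lemma tree_edges_Node_iff:
  "(x, y) \<in> tree_edges (Node c l ts) \<longleftrightarrow>
    y = l \<and> x \<in> root_label ` set ts \<or> (\<exists>u \<in> set ts. (x, y) \<in> tree_edges u)"
  by auto

text \<open>Supplies the hypothesis \<open>par\<close> of \<open>ex_tableau_of_parent_rel\<close>
  for edges of a tree.\<close>

lemma tree_edges_color: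
  "plane_alternative_tree t \<Longrightarrow> (x, y) \<in> tree_edges t \<Longrightarrow>
    \<exists>c d. c \<noteq> d \<and> x \<in> color_labels d t \<and> y \<in> color_labels c t \<and> color_ord c x y"
proof (induction t)
  case (Node c l ts)
  have pat: "plane_alternative_tree u" if "u \<in> set ts" for u
    using Node.prems(1) that by (simp add: plane_alternative_tree_Node plane_alternative_forest_def)
  from Node.prems(2) consider u where "u \<in> set ts" "y = l" "x = root_label u"
    | u where "u \<in> set ts" "(x, y) \<in> tree_edges u"
    by (auto simp: tree_edges_Node_iff)
  thus ?case
  proof cases
    case 1
    hence "color u \<noteq> c" "color_ord c x l"
      using Node.prems(1) by (auto simp: plane_alternative_tree_Node)
    moreover have "x \<in> color_labels (color u) u" using 1 root_in_color_labels by simp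
    ultimately show ?thesis using 1
      by (intro exI[of _ c] exI[of _ "color u"]) (auto simp: color_labels_Node)
  next
    case 2
    then obtain d e where "d \<noteq> e" "x \<in> color_labels e u" "y \<in> color_labels d u" "color_ord d x y"
      using Node.IH[of u] pat by blast
    thus ?thesis using 2
      by (intro exI[of _ d] exI[of _ e]) (auto simp: color_labels_Node)
  qed
qed

lemma forest_disjoint:
  assumes "plane_alternative_forest F" "t \<in> F" "u \<in> F" "x \<in> tree_labels t" "x \<in> tree_labels u"
  shows "t = u"
  using assms unfolding plane_alternative_forest_def pairwise_def disjnt_iff by blast

lemma forest_edge_in_tree:
  assumes "plane_alternative_forest F" "t \<in> F" "u \<in> F" "(x, y) \<in> tree_edges u"
    "x \<in> tree_labels t \<or> y \<in> tree_labels t"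
  shows "(x, y) \<in> tree_edges t"
  using assms forest_disjoint[OF assms(1-3)] tree_edges_subset[of u] by blast

lemma root_notin_Domain_tree_edges:
  assumes "plane_alternative_tree t"
  shows "root_label t \<notin> Domain (tree_edges t)"
proof (cases t)
  case (Node c l ts)
  have "l \<notin> tree_labels u" if "u \<in> set ts" for u
    using assms that root_notin_child_labels by (simp add: Node)
  thus ?thesis using tree_edges_subset root_in_tree_labels
    by (fastforce simp: Node)
qed

lemma Domain_tree_edges:
  assumes "plane_alternative_tree t"
  shows "Domain (tree_edges t) = tree_labels t - {root_label t}"
proof -
  have "x \<in> Domain (tree_edges t)" if "x \<in> tree_labels t" "x \<noteq> root_label t" for x
    using tree_edges_rtrancl[OF that(1)] that(2)
    by (subst (asm) converse_rtrancl_cases) blast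
  thus ?thesis
    using root_notin_Domain_tree_edges[OF assms] tree_edges_subset[of t] by blast
qed

text \<open>Labels of distinct vertices differ, so a label occurs at one vertex only and has the
  colour of that vertex.\<close>

lemma color_labels_disjoint:
  "plane_alternative_tree t \<Longrightarrow> x \<in> color_labels c t \<Longrightarrow> x \<in> color_labels d t \<Longrightarrow> c = d"
proof (induction t)
  case (Node e l ts)
  have F: "plane_alternative_forest (set ts)" and l: "\<And>u. u \<in> set ts \<Longrightarrow> l \<notin> tree_labels u"
    using Node.prems(1) root_notin_child_labels by (simp_all add: plane_alternative_tree_Node)
  show ?case
  proof (cases "x = l")
    case True
    thus ?thesis using Node.prems l
      by (auto simp: color_labels_Node tree_labels_color_labels split: if_splits)
  next
    case False
    then obtain u v where uv: "u \<in> set ts" "v \<in> set ts" "x \<in> color_labels c u" "x \<in> color_labels d v"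
      using Node.prems by (auto simp: color_labels_Node split: if_splits)
    hence "u = v" using forest_disjoint[OF F uv(1,2)] tree_labels_color_labels by blast
    thus ?thesis using Node.IH uv F by (auto simp: plane_alternative_forest_def)
  qed
qed

lemma single_valued_forest_edges:
  assumes F: "plane_alternative_forest F" and sv: "\<And>t. t \<in> F \<Longrightarrow> single_valued (tree_edges t)"
  shows "single_valued (\<Union>t \<in> F. tree_edges t)"
proof (rule single_valuedI)
  fix x y z assume "(x, y) \<in> (\<Union>t \<in> F. tree_edges t)" "(x, z) \<in> (\<Union>t \<in> F. tree_edges t)"
  then obtain t u where tu: "t \<in> F" "u \<in> F" "(x, y) \<in> tree_edges t" "(x, z) \<in> tree_edges u" by blast
  hence "(x, z) \<in> tree_edges t" using forest_edge_in_tree[OF F] tree_edges_subset[of t] by blast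
  thus "y = z" using sv tu by (auto dest: single_valuedD)
qed

text \<open>Edges in different subtrees cannot conflict by disjointness. A new edge starts at the
  root of a subtree, which has no parent inside any of the subtrees.\<close>

lemma single_valued_tree_edges:
  "plane_alternative_tree t \<Longrightarrow> single_valued (tree_edges t)"
proof (induction t)
  case (Node c l ts)
  have F: "plane_alternative_forest (set ts)" using Node.prems by (simp add: plane_alternative_tree_Node)
  hence pat: "\<And>u. u \<in> set ts \<Longrightarrow> plane_alternative_tree u" by (simp add: plane_alternative_forest_def)
  have sv: "single_valued (\<Union>u \<in> set ts. tree_edges u)"
    using single_valued_forest_edges[OF F] Node.IH pat by blast
  have root: "(root_label u, y) \<notin> tree_edges v" if "u \<in> set ts" "v \<in> set ts" for u v y
    using forest_edge_in_tree[OF F that, of "root_label u" y] root_notin_Domain_tree_edges[OF pat[OF that(1)]]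
    by auto
  show ?case
    using sv root by (auto simp: single_valued_def)
qed

text \<open>A grandchild of the root lies in a subtree and is compared with the root as one of its
  descendants; any other grandparent pair lies inside one subtree. This supplies the hypothesis
  \<open>grand\<close> of \<open>ex_tableau_of_parent_rel\<close>.\<close>

lemma tree_edges_grandparent:
  "plane_alternative_tree t \<Longrightarrow> (z, x) \<in> tree_edges t \<Longrightarrow> (x, y) \<in> tree_edges t \<Longrightarrow>
    \<exists>c. y \<in> color_labels c t \<and> color_ord c z y"
proof (induction t)
  case (Node c l ts)
  have F: "plane_alternative_forest (set ts)"
    and l: "\<And>u x. u \<in> set ts \<Longrightarrow> x \<in> tree_labels u \<Longrightarrow> color_ord c x l"
    using Node.prems(1) by (auto simp: plane_alternative_tree_Node)
  hence pat: "\<And>u. u \<in> set ts \<Longrightarrow> plane_alternative_tree u" by (simp add: plane_alternative_forest_def)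
  \<comment> \<open>Labels of subtrees differ from \<open>l\<close>, so an edge into
    \<open>x\<close> is not one of the new edges and belongs to the subtree containing
    \<open>x\<close>.\<close>
  have sub: "(z, x) \<in> tree_edges u" if "u \<in> set ts" "x \<in> tree_labels u" for u
  proof -
    have "x \<noteq> l" using l[OF that] by auto
    thus ?thesis using Node.prems(2) that forest_edge_in_tree[OF F that(1)]
      by (auto simp: tree_edges_Node_iff)
  qed
  from Node.prems(3) consider u where "u \<in> set ts" "y = l" "x = root_label u"
    | u where "u \<in> set ts" "(x, y) \<in> tree_edges u"
    by (auto simp: tree_edges_Node_iff)
  thus ?case
  proof cases
    case 1
    hence "z \<in> tree_labels u" using sub[of u] tree_edges_subset[of u] by auto
    thus ?thesis using 1 l by (intro exI[of _ c]) (auto simp: color_labels_Node)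
  next
    case 2
    hence "(z, x) \<in> tree_edges u" using sub[of u] tree_edges_subset[of u] by auto
    then obtain d where "y \<in> color_labels d u" "color_ord d z y" using 2 Node.IH[of u] pat by blast
    thus ?thesis using 2 by (intro exI[of _ d]) (auto simp: color_labels_Node)
  qed
qed

subsection \<open>Tableaux encoding forests\<close>

text \<open>The correspondence behind both bijections: the same coloured labels and the same parent
  relation. The order of children is absent because sorting restores it.\<close>

definition encodes :: "tableau \<Rightarrow> ptree set \<Rightarrow> bool" where
  "encodes T F \<longleftrightarrow> (\<forall>c. lines T c = (\<Union>t \<in> F. color_labels c t)) \<and>
     parent_rel T = (\<Union>t \<in> F. tree_edges t)"

lemma ex_encoding_tableau:
  assumes F: "plane_alternative_forest F"
  shows "\<exists>T. alternative_tableau T \<and> encodes T F"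
proof -
  let ?L = "\<lambda>c. \<Union>t \<in> F. color_labels c t" and ?P = "\<Union>t \<in> F. tree_edges t"
  have pat: "\<And>t. t \<in> F \<Longrightarrow> plane_alternative_tree t" and fin: "finite F"
    using F by (simp_all add: plane_alternative_forest_def)
  have uniq: "c = d" if "x \<in> ?L c" "x \<in> ?L d" for x c d
  proof -
    obtain t u where tu: "t \<in> F" "u \<in> F" "x \<in> color_labels c t" "x \<in> color_labels d u" using \<open>x \<in> ?L c\<close> \<open>x \<in> ?L d\<close> by blast
    hence "t = u" using forest_disjoint[OF F tu(1,2)] tree_labels_color_labels by blast
    thus ?thesis using tu color_labels_disjoint pat by blast
  qed
  have "\<exists>T. alternative_tableau T \<and> rows T = ?L White \<and> cols T = ?L Black \<and> parent_rel T = ?P"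
  proof (rule ex_tableau_of_parent_rel)
    have "?L White \<union> ?L Black \<subseteq> (\<Union>t \<in> F. tree_labels t)" using tree_labels_color_labels by blast
    thus "finite (?L White \<union> ?L Black)" by (rule finite_subset) (use fin in simp)
    show "?L White \<inter> ?L Black = {}" using uniq by blast
    show "single_valued ?P"
      using single_valued_forest_edges[OF F] single_valued_tree_edges pat by blast
  next
    fix x y assume "(x, y) \<in> ?P"
    then obtain t where t: "t \<in> F" "(x, y) \<in> tree_edges t" by blast
    then obtain c d where "c \<noteq> d" "x \<in> color_labels d t" "y \<in> color_labels c t" "color_ord c x y"
      using tree_edges_color pat by blast
    thus "x \<in> ?L White \<and> y \<in> ?L Black \<and> x < y \<or> x \<in> ?L Black \<and> y \<in> ?L White \<and> y < x"
      using t by (cases c; cases d) auto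
  next
    fix x y z assume *: "(z, x) \<in> ?P" "(x, y) \<in> ?P"
    then obtain t where t: "t \<in> F" "(x, y) \<in> tree_edges t" by blast
    moreover have "(z, x) \<in> tree_edges t"
      using * t tree_edges_subset[of t] forest_edge_in_tree[OF F t(1)] by blast
    ultimately obtain c where c: "y \<in> color_labels c t" "color_ord c z y"
      using tree_edges_grandparent pat by blast
    \<comment> \<open>A label of the forest has one colour, so the test for a white label in
      \<open>grand\<close> identifies \<open>c\<close>.\<close>
    hence "y \<in> ?L White \<longleftrightarrow> c = White" using uniq[of y c White] t by blast
    thus "if y \<in> ?L White then y < z else z < y" using c by (cases c) auto
  qed
  then obtain T where T: "alternative_tableau T" "rows T = ?L White" "cols T = ?L Black" "parent_rel T = ?P"
    by blast
  hence "lines T c = ?L c" for c by (cases c) auto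
  thus ?thesis using T unfolding encodes_def by blast
qed

lemma encodes_unique:
  "alternative_tableau T \<Longrightarrow> alternative_tableau U \<Longrightarrow> encodes T F \<Longrightarrow> encodes U F \<Longrightarrow> T = U"
  by (rule tableau_eqI) (auto simp: encodes_def)

lemma encodes_labels: "encodes T F \<Longrightarrow> labels T = (\<Union>t \<in> F. tree_labels t)"
  unfolding encodes_def set_eq_iff labels_lines UN_iff tree_labels_color_labels by blast

lemma plane_alternative_forest_singleton [simp]:
  "plane_alternative_forest {t} \<longleftrightarrow> plane_alternative_tree t"
  by (simp add: plane_alternative_forest_def)

context
  fixes T :: tableau and F :: "ptree set"
  assumes alt: "alternative_tableau T" and F: "plane_alternative_forest F" and enc: "encodes T F"
begin

lemma encodes_edge_in_tree:
  assumes "t \<in> F" "x \<in> tree_labels t \<or> y \<in> tree_labels t"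
  shows "(x, y) \<in> parent_rel T \<longleftrightarrow> (x, y) \<in> tree_edges t"
  using enc forest_edge_in_tree[OF F assms(1)] assms by (auto simp: encodes_def)

lemma encodes_Free: "Free T = root_label ` F"
proof -
  have pat: "\<And>t. t \<in> F \<Longrightarrow> plane_alternative_tree t"
    using F by (simp add: plane_alternative_forest_def)
  have "x \<in> Domain (parent_rel T) \<longleftrightarrow> x \<noteq> root_label t" if "t \<in> F" "x \<in> tree_labels t" for x t
    using Domain_tree_edges[OF pat[OF that(1)]] encodes_edge_in_tree[OF that(1)] that by blast
  thus ?thesis
    unfolding Free_eq[OF alt] encodes_labels[OF enc] using root_in_tree_labels by blast
qed

lemma encodes_component:
  assumes "t \<in> F"
  shows "component T (root_label t) = tree_labels t"
proof -
  have "component T (root_label t) = {x. (x, root_label t) \<in> (parent_rel T)\<^sup>*}"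
    using component_eq[OF alt] encodes_Free assms by blast
  moreover have "x \<in> tree_labels t" if "(x, root_label t) \<in> (parent_rel T)\<^sup>*" for x
    using that
  proof (induction rule: converse_rtrancl_induct)
    case (step y z)
    thus ?case using encodes_edge_in_tree[OF assms] tree_edges_subset by blast
  qed simp
  moreover have "tree_edges t \<subseteq> parent_rel T" using enc assms by (auto simp: encodes_def)
  hence "(tree_edges t)\<^sup>* \<subseteq> (parent_rel T)\<^sup>*" by (rule rtrancl_mono)
  ultimately show ?thesis using tree_edges_rtrancl[of _ t] by blast
qed

text \<open>The component of the root of \<open>t\<close> is its label set, and disjointness of the
  trees confines colours and edges on these labels to \<open>t\<close>.\<close>

lemma encodes_subtableau:
  assumes "t \<in> F"
  shows "encodes (subtableau T (root_label t)) {t}"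
proof -
  have "lines T c \<inter> tree_labels t = color_labels c t" for c
  proof
    show "color_labels c t \<subseteq> lines T c \<inter> tree_labels t"
      using enc assms by (auto simp: encodes_def tree_labels_color_labels)
    show "lines T c \<inter> tree_labels t \<subseteq> color_labels c t"
    proof
      fix x assume x: "x \<in> lines T c \<inter> tree_labels t"
      then obtain u where u: "u \<in> F" "x \<in> color_labels c u" using enc by (auto simp: encodes_def)
      moreover have "t = u"
        using forest_disjoint[OF F assms u(1)] x u(2) tree_labels_color_labels by blast
      ultimately show "x \<in> color_labels c t" by simp
    qed
  qed
  moreover have "parent_rel T \<inter> tree_labels t \<times> tree_labels t = tree_edges t"
    using encodes_edge_in_tree[OF assms] tree_edges_subset[of t] by auto
  ultimately show ?thesis
    unfolding encodes_def by (simp add: subtableau_def encodes_component[OF assms])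
qed

end

section \<open>\<open>Tree\<close> recovers the encoded tree\<close>

text \<open>The root label occurs in no subtree, so deleting it takes away its colour entry and the
  edges into it and leaves the forest of its children intact.\<close>

lemma encodes_cut_root:
  assumes t: "plane_alternative_tree (Node c l ts)" and enc: "encodes T {Node c l ts}"
  shows "encodes (cut_root T l) (set ts)"
proof -
  have l: "l \<notin> tree_labels u" if "u \<in> set ts" for u
    using root_notin_child_labels[OF t that] .
  have L: "labels T - {l} = (\<Union>u \<in> set ts. tree_labels u)"
    using encodes_labels[OF enc] l by (auto simp: tree_labels_Node)
  have "lines T d \<inter> (labels T - {l}) = (\<Union>u \<in> set ts. color_labels d u)" for d
  proof -
    have "lines T d = (if d = c then {l} else {}) \<union> (\<Union>u \<in> set ts. color_labels d u)"
      using enc by (simp add: encodes_def color_labels_Node)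
    moreover have "(\<Union>u \<in> set ts. color_labels d u) \<subseteq> (\<Union>u \<in> set ts. tree_labels u)"
      using tree_labels_color_labels by blast
    ultimately show ?thesis unfolding L using l by (auto split: if_splits)
  qed
  moreover have "parent_rel T \<inter> (labels T - {l}) \<times> (labels T - {l}) = (\<Union>u \<in> set ts. tree_edges u)"
  proof -
    have "parent_rel T = (\<lambda>u. (root_label u, l)) ` set ts \<union> (\<Union>u \<in> set ts. tree_edges u)"
      using enc by (simp add: encodes_def)
    moreover have "(\<Union>u \<in> set ts. tree_edges u) \<subseteq> (labels T - {l}) \<times> (labels T - {l})"
      unfolding L using tree_edges_subset by blast
    ultimately show ?thesis by blast
  qed
  ultimately show ?thesis by (simp add: encodes_def cut_root_def)
qed

text \<open>After the cut, the split tableaux encode the individual children, which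
  \<open>Tree\<close> returns by induction. The list \<open>ts\<close> is already sorted as
  \<open>arrange\<close> demands, so the plane structure is recovered too.\<close>

lemma Tree_encodes:
  "alternative_tableau T \<Longrightarrow> plane_alternative_tree t \<Longrightarrow> encodes T {t} \<Longrightarrow> Tree T = t"
proof (induction t arbitrary: T)
  case (Node c l ts)
  note t = Node.prems(2)
  have F: "plane_alternative_forest (set ts)" "sorted_wrt (color_ord c) (map root_label ts)"
    using t by (simp_all add: plane_alternative_tree_Node)
  have r: "Free T = {l}"
    using encodes_Free[OF Node.prems(1) _ Node.prems(3)] t by simp
  moreover have "l \<in> lines T c" using Node.prems(3) by (simp add: encodes_def color_labels_Node)
  ultimately have Tree: "Tree T = Node c l (arrange (color_ord c) (Tree ` split (cut_root T l)))"
    using Tree_unfold Node.prems(1) by blast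
  let ?C = "cut_root T l"
  have alt: "alternative_tableau ?C"
    unfolding cut_root_def using alternative_restrict Node.prems(1) by blast
  have enc: "encodes ?C (set ts)" using encodes_cut_root[OF t Node.prems(3)] .
  have "Tree (subtableau ?C (root_label u)) = u" if "u \<in> set ts" for u
    using Node.IH[OF that alternative_subtableau[OF alt] _ encodes_subtableau[OF alt F(1) enc that]] F(1) that
    by (simp add: plane_alternative_forest_def)
  hence "Tree ` split ?C = set ts"
    unfolding split_def encodes_Free[OF alt F(1) enc] image_image by simp
  thus ?case
    using Tree arrange_eqI[of "color_ord c" ts] F(2) by (cases c) auto
qed

section \<open>Construction of an encoding forest for a tableau\<close>

text \<open>The components partition the labels and no edge leaves a component, so encodings of the
  pieces assemble to one of the whole tableau.\<close>

lemma encodes_union: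
  assumes alt: "alternative_tableau T"
    and f: "\<And>k. k \<in> Free T \<Longrightarrow> plane_alternative_tree (f k) \<and> encodes (subtableau T k) {f k}"
  shows "plane_alternative_forest (f ` Free T)" "encodes T (f ` Free T)"
    "\<And>k. k \<in> Free T \<Longrightarrow> root_label (f k) = k"
proof -
  have lab: "tree_labels (f k) = component T k" if "k \<in> Free T" for k
    using encodes_labels[of "subtableau T k" "{f k}"] f[OF that] component_subset_labels[OF alt that]
    by (auto simp: subtableau_def)
  have "finite (labels T)" using alt by (simp add: alternative_tableau_def)
  hence "finite (Free T)" by (simp add: Free_eq[OF alt])
  moreover have "disjnt (tree_labels (f k)) (tree_labels (f k'))"
    if "k \<in> Free T" "k' \<in> Free T" "f k \<noteq> f k'" for k k'
    using components_disjoint[OF alt that(1,2)] that lab by (auto simp: disjnt_def)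
  ultimately show "plane_alternative_forest (f ` Free T)"
    using f by (auto simp: plane_alternative_forest_def pairwise_def)
  have "lines T c = (\<Union>k \<in> Free T. color_labels c (f k))" for c
  proof -
    have "color_labels c (f k) = lines T c \<inter> component T k" if "k \<in> Free T" for k
      using f[OF that] by (auto simp: encodes_def subtableau_def)
    moreover have "lines T c \<subseteq> (\<Union>k \<in> Free T. component T k)"
      using UN_components[OF alt] labels_lines by blast
    ultimately show ?thesis by auto
  qed
  moreover have "parent_rel T = (\<Union>k \<in> Free T. tree_edges (f k))"
  proof -
    have "tree_edges (f k) = parent_rel T \<inter> component T k \<times> component T k" if "k \<in> Free T" for k
      using f[OF that] by (auto simp: encodes_def subtableau_def)
    moreover have "parent_rel T \<subseteq> (\<Union>k \<in> Free T. component T k \<times> component T k)"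
    proof clarify
      fix x y assume xy: "(x, y) \<in> parent_rel T"
      hence "x \<in> (\<Union>k \<in> Free T. component T k)"
        using UN_components[OF alt] parent_rel_labels[OF alt] by auto
      then obtain k where "k \<in> Free T" "x \<in> component T k" by blast
      thus "(x, y) \<in> (\<Union>k \<in> Free T. component T k \<times> component T k)"
        using component_closed[OF alt _ xy] by blast
    qed
    ultimately show ?thesis by auto
  qed
  ultimately show "encodes T (f ` Free T)" by (simp add: encodes_def)
  show "root_label (f k) = k" if "k \<in> Free T" for k
    using encodes_Free[OF alternative_subtableau[OF alt], of "{f k}" k] f[OF that]
      Free_subtableau[OF alt that] by simp
qed

lemma ex_sorted_children:
  assumes "finite F" "inj_on root_label F"
  shows "\<exists>ts. set ts = F \<and> sorted_wrt (color_ord c) (map root_label ts)"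
proof -
  \<comment> \<open>Sort the root labels, reversing the list below a white root, and let
    \<open>?g\<close> return the tree with a given root label.\<close>
  let ?ls = "sorted_list_of_set (root_label ` F)" and ?g = "inv_into F root_label"
  have g: "map root_label (map ?g xs) = xs" if "set xs \<subseteq> root_label ` F" for xs
    using that unfolding map_map by (intro map_idI) (auto intro: f_inv_into_f)
  have s: "set (map ?g xs) = F" if "set xs = root_label ` F" for xs
    using that assms by (simp add: image_image)
  have ls: "set ?ls = root_label ` F" "sorted_wrt (<) ?ls" using assms by simp_all
  show ?thesis
  proof (cases c)
    case White
    have "sorted_wrt (>) (rev ?ls)" using ls by (simp add: sorted_wrt_rev)
    thus ?thesis using White g[of "rev ?ls"] s[of "rev ?ls"] ls
      by (intro exI[of _ "map ?g (rev ?ls)"]) simp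
  next
    case Black
    thus ?thesis using g[of ?ls] s[of ?ls] ls by (intro exI[of _ "map ?g ?ls"]) simp
  qed
qed

text \<open>Induction on the number of labels: delete the root, encode each component of the rest by
  a tree, and attach these trees, suitably sorted, below a new vertex for the root.\<close>

lemma packed_encoding_tree:
  "packed T \<Longrightarrow> \<exists>t. plane_alternative_tree t \<and> encodes T {t}"
proof (induction "card (labels T)" arbitrary: T rule: less_induct)
  case less
  obtain r where alt: "alternative_tableau T" and r: "Free T = {r}"
    using less.prems packed_iff by blast
  have fin: "finite (labels T)" using alt by (simp add: alternative_tableau_def)
  have rl: "r \<in> labels T" using r Free_eq[OF alt] by auto
  obtain c where c: "r \<in> lines T c" using rl labels_lines by blast
  let ?C = "cut_root T r"
  have altC: "alternative_tableau ?C"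
    unfolding cut_root_def using alternative_restrict alt by blast
  have lC: "labels ?C = labels T - {r}" by (auto simp: cut_root_def)
  have "\<exists>t. plane_alternative_tree t \<and> encodes (subtableau ?C k) {t}" if k: "k \<in> Free ?C" for k
  proof (rule less.hyps)
    show "packed (subtableau ?C k)" using packed_subtableau[OF altC k] .
    have "labels (subtableau ?C k) \<subset> labels T" using lC rl by (auto simp: subtableau_def)
    thus "card (labels (subtableau ?C k)) < card (labels T)" using fin psubset_card_mono by blast
  qed
  then obtain f where f: "\<And>k. k \<in> Free ?C \<Longrightarrow> plane_alternative_tree (f k) \<and> encodes (subtableau ?C k) {f k}"
    by metis
  let ?F = "f ` Free ?C"
  note F = encodes_union[OF altC f]
  have rootF: "root_label ` ?F = Free ?C" using F(3) by (simp add: image_image)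
  have "inj_on root_label ?F" using F(3) by (auto intro!: inj_onI)
  moreover have "finite ?F" using F(1) by (simp add: plane_alternative_forest_def)
  ultimately obtain ts where ts: "set ts = ?F" "sorted_wrt (color_ord c) (map root_label ts)"
    using ex_sorted_children by blast
  let ?t = "Node c r ts"
  have linesC: "lines ?C d = lines T d - {r}" for d
    using labels_lines by (auto simp: cut_root_def)
  \<comment> \<open>The roots of the new subtrees are the free lines after the cut, hence children
    of \<open>r\<close> and of the opposite colour.\<close>
  have "color u \<noteq> c" if u: "u \<in> ?F" for u
  proof -
    have "(root_label u, r) \<in> parent_rel T"
      using u rootF Free_cut_root[OF alt r] by blast
    then obtain d where "root_label u \<in> lines T d" "d \<noteq> c"
      using c lines_unique by (metis parent_rel_lines[OF alt])
    moreover have "root_label u \<in> lines ?C (color u)"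
      using F(2) u root_in_color_labels unfolding encodes_def by blast
    ultimately show ?thesis using linesC lines_unique by blast
  qed
  moreover have "color_ord c x r" if "u \<in> ?F" "x \<in> tree_labels u" for u x
    using encodes_labels[OF F(2)] that lC root_ord[OF alt r c, of x] by blast
  ultimately have t: "plane_alternative_tree ?t"
    unfolding plane_alternative_tree_Node ts(1) using F(1) ts(2) by blast
  have "lines T d = color_labels d ?t" for d
  proof -
    have "(\<Union>u \<in> set ts. color_labels d u) = lines T d - {r}"
      using F(2) linesC unfolding encodes_def ts(1) by simp
    moreover have "r \<in> lines T d \<longleftrightarrow> d = c" using c lines_unique by blast
    ultimately show ?thesis by (auto simp: color_labels_Node)
  qed
  moreover have "parent_rel T = tree_edges ?t"
  proof -
    \<comment> \<open>\<open>r\<close> has no parent, so an edge either ends at \<open>r\<close> or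
      avoids it and survives the cut.\<close>
    have "parent_rel T = (\<lambda>x. (x, r)) ` {x. (x, r) \<in> parent_rel T} \<union> parent_rel ?C"
      using parent_rel_labels[OF alt] r Free_eq[OF alt] by (auto simp: cut_root_def)
    also have "{x. (x, r) \<in> parent_rel T} = root_label ` set ts"
      using Free_cut_root[OF alt r] rootF ts(1) by simp
    also have "parent_rel ?C = (\<Union>u \<in> set ts. tree_edges u)"
      using F(2) ts(1) by (simp add: encodes_def)
    finally show ?thesis by (simp add: image_image)
  qed
  ultimately have "encodes T {?t}" by (simp add: encodes_def)
  thus ?case using t by blast
qed

lemma ex_encoding_forest:
  assumes alt: "alternative_tableau T"
  shows "\<exists>F. plane_alternative_forest F \<and> encodes T F"
proof -
  have "\<exists>t. plane_alternative_tree t \<and> encodes (subtableau T k) {t}" if "k \<in> Free T" for k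
    by (rule packed_encoding_tree[OF packed_subtableau[OF alt that]])
  then obtain f where
    f: "\<And>k. k \<in> Free T \<Longrightarrow> plane_alternative_tree (f k) \<and> encodes (subtableau T k) {f k}"
    by metis
  show ?thesis using encodes_union(1,2)[OF alt f] by blast
qed

lemma Forest_encodes:
  assumes "alternative_tableau T" "plane_alternative_forest F" "encodes T F"
  shows "Forest T = F"
proof -
  have "Tree (subtableau T (root_label t)) = t" if "t \<in> F" for t
    using Tree_encodes[OF alternative_subtableau[OF assms(1)] _ encodes_subtableau[OF assms that]] assms(2) that
    by (simp add: plane_alternative_forest_def)
  thus ?thesis
    unfolding Forest_def split_def encodes_Free[OF assms] image_image by simp
qed

section \<open>Vertex counts and the two bijections\<close>

lemma num_vertices_eq_card:
  "plane_alternative_tree t \<Longrightarrow> num_vertices t = card (tree_labels t)"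
  unfolding plane_alternative_tree_def num_vertices_def tree_labels_def
  by (metis distinct_card length_map set_map)

lemma forest_num_vertices_eq_card:
  assumes "plane_alternative_forest F"
  shows "forest_num_vertices F = card (forest_labels F)"
proof -
  have "card (forest_labels F) = (\<Sum>t \<in> F. card (tree_labels t))"
    using assms unfolding forest_labels_def plane_alternative_forest_def pairwise_def
    by (intro card_UN_disjoint) (auto simp: disjnt_def)
  also have "\<dots> = forest_num_vertices F"
    using assms num_vertices_eq_card by (simp add: forest_num_vertices_def plane_alternative_forest_def)
  finally show ?thesis by simp
qed

theorem theorem4p4:
  fixes L :: "int set" and n :: nat
  assumes "finite L" and "card L = n"
  shows "bij_betw Tree
           {T. packed T \<and> labels T = L}
           {t. plane_alternative_tree t \<and> num_vertices t = n \<and> tree_labels t = L} \<and>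
         bij_betw Forest
           {T. alternative_tableau T \<and> tableau_length T = n \<and> labels T = L}
           {F. plane_alternative_forest F \<and> forest_num_vertices F = n \<and> forest_labels F = L}"
proof
  \<comment> \<open>Some tree is encoded by \<open>T\<close>, and \<open>Tree_encodes\<close>
    identifies it as \<open>Tree T\<close>.\<close>
  have enc_tree: "plane_alternative_tree (Tree T) \<and> encodes T {Tree T}" if "packed T" for T
    using packed_encoding_tree[OF that] Tree_encodes that packed_iff by blast
  show "bij_betw Tree {T. packed T \<and> labels T = L}
           {t. plane_alternative_tree t \<and> num_vertices t = n \<and> tree_labels t = L}"
  proof (rule bij_betw_imageI)
    \<comment> \<open>Tableaux with the same image encode the same tree and therefore
      coincide.\<close>
    show "inj_on Tree {T. packed T \<and> labels T = L}"
      using enc_tree encodes_unique packed_iff by (auto intro!: inj_onI) metis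
    show "Tree ` {T. packed T \<and> labels T = L} =
        {t. plane_alternative_tree t \<and> num_vertices t = n \<and> tree_labels t = L}"
    proof (intro equalityI subsetI)
      fix t assume "t \<in> Tree ` {T. packed T \<and> labels T = L}"
      thus "t \<in> {t. plane_alternative_tree t \<and> num_vertices t = n \<and> tree_labels t = L}"
        using enc_tree encodes_labels num_vertices_eq_card assms(2) by fastforce
    next
      fix t assume "t \<in> {t. plane_alternative_tree t \<and> num_vertices t = n \<and> tree_labels t = L}"
      hence t: "plane_alternative_tree t" "tree_labels t = L" by auto
      then obtain T where T: "alternative_tableau T" "encodes T {t}"
        using ex_encoding_tableau[of "{t}"] by auto
      \<comment> \<open>The free lines of an encoding tableau are the roots of its forest, so a
        single tree yields a packed tableau.\<close>
      have "Free T = {root_label t}" using encodes_Free[OF T(1) _ T(2)] t by simp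
      hence "packed T" using T packed_iff by blast
      moreover have "labels T = L" using encodes_labels[OF T(2)] t by simp
      ultimately show "t \<in> Tree ` {T. packed T \<and> labels T = L}"
        using Tree_encodes[OF T(1) t(1) T(2)] by force
    qed
  qed
next
  \<comment> \<open>As for trees: a forest encoded by \<open>T\<close> exists, and it must be
    \<open>Forest T\<close>.\<close>
  have enc_forest: "plane_alternative_forest (Forest T) \<and> encodes T (Forest T)"
    if "alternative_tableau T" for T
    using ex_encoding_forest[OF that] Forest_encodes[OF that] by blast
  show "bij_betw Forest
           {T. alternative_tableau T \<and> tableau_length T = n \<and> labels T = L}
           {F. plane_alternative_forest F \<and> forest_num_vertices F = n \<and> forest_labels F = L}"
  proof (rule bij_betw_imageI)
    show "inj_on Forest {T. alternative_tableau T \<and> tableau_length T = n \<and> labels T = L}"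
      using enc_forest encodes_unique by (auto intro!: inj_onI) metis
    show "Forest ` {T. alternative_tableau T \<and> tableau_length T = n \<and> labels T = L} =
        {F. plane_alternative_forest F \<and> forest_num_vertices F = n \<and> forest_labels F = L}"
    proof (intro equalityI subsetI)
      fix F assume "F \<in> Forest ` {T. alternative_tableau T \<and> tableau_length T = n \<and> labels T = L}"
      then obtain T where T: "alternative_tableau T" "labels T = L" "F = Forest T" by auto
      hence "plane_alternative_forest F" "forest_labels F = L"
        using enc_forest[OF T(1)] encodes_labels[of T F] by (auto simp: forest_labels_def)
      thus "F \<in> {F. plane_alternative_forest F \<and> forest_num_vertices F = n \<and> forest_labels F = L}"
        using forest_num_vertices_eq_card assms(2) by auto
    next
      fix F assume "F \<in> {F. plane_alternative_forest F \<and> forest_num_vertices F = n \<and> forest_labels F = L}"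
      hence F: "plane_alternative_forest F" "forest_labels F = L" by auto
      then obtain T where T: "alternative_tableau T" "encodes T F"
        using ex_encoding_tableau by blast
      moreover have "labels T = L" using encodes_labels[OF T(2)] F by (simp add: forest_labels_def)
      ultimately show "F \<in> Forest ` {T. alternative_tableau T \<and> tableau_length T = n \<and> labels T = L}"
        using Forest_encodes[OF T(1) F(1) T(2)] assms(2) by (force simp: tableau_length_def)
    qed
  qed
qed

end
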